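(* Let $(X,G)$ be a topological dynamical system, where $G$ is a countable infinite discrete amenable group, let $\mu\in\mathcal{M}(X,G)$, and let $\{F_n:n\in\mathbb{N}\}$ be a F\o lner sequence of $G$. Let $h\in L^2(X,\mu)$ and $H(x,y)=|h(x)-h(y)|$ for all $x,y\in X$. Then the function $h$ is almost periodic if and only if $\mu$ has bounded complexity w.r.t. $\{\overline{H}_{F_n}:n\in\mathbb{N}\}$.
   Context: A topological dynamical system $(X,G)$ is a pair where $X$ is a compact metric space with metric $d$ and $G$ is a countable infinite discrete amenable group acting on $X$ as a group of homeomorphisms. $\mathcal{M}(X,G)$ is the set of $G$-invariant Borel probability measures on $X$. A F\o lner sequence of $G$ is a sequence of finite nonempty subsets $F_n\subset G$ with $\lim_{n\to\infty}|gF_n\Delta F_n|/|F_n|=0$ for every $g\in G$. $L^2(X,\mu)$ consists of complex-valued functions, and $h$ is regarded as an everywhere-defined finite-valued Borel function. For $g\in G$, $(f\circ g)(x)=f(gx)$. A function $f\in L^2(X,\mu)$ is almost periodic if $\{f\circ g:g\in G\}$ is precompact in $L^2(X,\mu)$. For a semimetric $w$ on $X$ (nonnegative, zero on the diagonal, symmetric, satisfying the triangle inequality) put $\overline{w}_{F_n}(x,y)=\frac{1}{|F_n|}\sum_{g\in F_n}w(gx,gy)$ and $B_{\overline{w}_{F_n}}(x,r)=\{y\in X:\overline{w}_{F_n}(x,y)<r\}$. For $\epsilon>0$, $$C(\overline{w}_{F_n},\epsilon)=\min\Big\{m\in\mathbb{N}:\exists x_1,\dots,x_m\in X \text{ s.t.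 } \mu\Big(\bigcup_{i=1}^m B_{\overline{w}_{F_n}}(x_i,\epsilon/2)\Big)>1-\epsilon\Big\}.$$ $\mu$ has bounded complexity w.r.t. $\{\overline{w}_{F_n}:n\in\mathbb{N}\}$ if for every $\epsilon>0$ there is $M=M(\epsilon)\in\mathbb{N}$ with $C(\overline{w}_{F_n},\epsilon)\le M$ for all $n\in\mathbb{N}$. *)

theory Defs
  imports
    "HOL-Probability.Probability"
    "HOL-Algebra.Group_Action"
    "HOL-Library.Extended_Nat"
begin

section \<open>Amenable groups and topological dynamical systems\<close>

text \<open>
  Amenability of a discrete group in the sense of von Neumann: there is a finitely additive
  left-invariant probability defined on all subsets of the group.
\<close>

definition amenable :: "('g, 'b) monoid_scheme \<Rightarrow> bool" where
  "amenable G \<longleftrightarrow>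
     (\<exists>m :: 'g set \<Rightarrow> real.
        (\<forall>A. A \<subseteq> carrier G \<longrightarrow> 0 \<le> m A) \<and>
        m (carrier G) = 1 \<and>
        (\<forall>A B. A \<subseteq> carrier G \<longrightarrow> B \<subseteq> carrier G \<longrightarrow> A \<inter> B = {} \<longrightarrow>
                m (A \<union> B) = m A + m B) \<and>
        (\<forall>g A. g \<in> carrier G \<longrightarrow> A \<subseteq> carrier G \<longrightarrow> m (g <#\<^bsub>G\<^esub> A) = m A))"

definition Folner_sequence :: "('g, 'b) monoid_scheme \<Rightarrow> (nat \<Rightarrow> 'g set) \<Rightarrow> bool" where
  "Folner_sequence G F \<longleftrightarrow>
     (\<forall>n. F n \<subseteq> carrier G \<and> finite (F n) \<and> F n \<noteq> {}) \<and>
     (\<forall>g \<in> carrier G.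
        (\<lambda>n. real (card (sym_diff (g <#\<^bsub>G\<^esub> F n) (F n))) / real (card (F n))) \<longlonglongrightarrow> 0)"

text \<open>
  The phase space is the whole type \<open>'x\<close>, with its metric \<^const>\<open>dist\<close>; the point \<open>g x\<close> is
  \<open>\<phi> g x\<close>.
\<close>

locale topological_dynamical_system =
  group_action G "UNIV :: 'x set" \<phi>
  for G :: "('g, 'b) monoid_scheme" and \<phi> :: "'g \<Rightarrow> 'x::metric_space \<Rightarrow> 'x" +
  assumes compact_phase_space: "compact (UNIV :: 'x set)"
    and countable_group: "countable (carrier G)"
    and infinite_group: "infinite (carrier G)"
    and amenable_group: "amenable G"
    and homeomorphism_action:
      "g \<in> carrier G \<Longrightarrow> \<exists>k. homeomorphism UNIV UNIV (\<phi> g) k"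

definition invariant_measures ::
  "('g, 'b) monoid_scheme \<Rightarrow> ('g \<Rightarrow> 'x::metric_space \<Rightarrow> 'x) \<Rightarrow> 'x measure set" where
  "invariant_measures G \<phi> =
     {\<mu>. sets \<mu> = sets borel \<and> prob_space \<mu> \<and> (\<forall>g \<in> carrier G. distr \<mu> borel (\<phi> g) = \<mu>)}"


section \<open>The metric space \<open>L\<^sup>2\<close>\<close>

definition L2_functions :: "'x measure \<Rightarrow> ('x \<Rightarrow> complex) set" where
  "L2_functions M =
     {f. f \<in> borel_measurable M \<and> integrable M (\<lambda>x. (cmod (f x))\<^sup>2)}"

definition L2_norm :: "'x measure \<Rightarrow> ('x \<Rightarrow> complex) \<Rightarrow> real" where
  "L2_norm M f = sqrt (\<integral>x. (cmod (f x))\<^sup>2 \<partial>M)"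

definition ae_equal :: "'x measure \<Rightarrow> (('x \<Rightarrow> complex) \<times> ('x \<Rightarrow> complex)) set" where
  "ae_equal M =
     {(f, g). f \<in> L2_functions M \<and> g \<in> L2_functions M \<and> (AE x in M. f x = g x)}"

definition L2_class :: "'x measure \<Rightarrow> ('x \<Rightarrow> complex) \<Rightarrow> ('x \<Rightarrow> complex) set" where
  "L2_class M f = ae_equal M `` {f}"

definition L2_space :: "'x measure \<Rightarrow> ('x \<Rightarrow> complex) set set" where
  "L2_space M = L2_functions M // ae_equal M"

text \<open>The choice of representatives is immaterial, see \<open>L2_dist_class\<close> below.\<close>

definition L2_dist ::
  "'x measure \<Rightarrow> ('x \<Rightarrow> complex) set \<Rightarrow> ('x \<Rightarrow> complex) set \<Rightarrow> real" where
  "L2_dist M A B = L2_norm M (\<lambda>x. (SOME f. f \<in> A) x - (SOME f. f \<in> B) x)"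

abbreviation L2_topology :: "'x measure \<Rightarrow> ('x \<Rightarrow> complex) set topology" where
  "L2_topology M \<equiv> Metric_space.mtopology (L2_space M) (L2_dist M)"

lemma L2_norm_nonneg: "0 \<le> L2_norm M f"
  by (simp add: L2_norm_def)

lemma L2_norm_cong:
  assumes "f \<in> borel_measurable M" "g \<in> borel_measurable M" "AE x in M. f x = g x"
  shows "L2_norm M f = L2_norm M g"
  unfolding L2_norm_def using assms by (intro arg_cong[where f = sqrt] integral_cong_AE) auto

lemma cmod_add_sq_le:
  fixes z w :: complex and a b :: real
  assumes "a > 0" "b > 0"
  shows "(cmod (z + w))\<^sup>2 \<le> (1 + b / a) * (cmod z)\<^sup>2 + (1 + a / b) * (cmod w)\<^sup>2"
proof -
  have "2 * cmod z * cmod w \<le> (b / a) * (cmod z)\<^sup>2 + (a / b) * (cmod w)\<^sup>2"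
  proof -
    have "0 \<le> (b * cmod z - a * cmod w)\<^sup>2 / (a * b)"
      using assms by simp
    also have "\<dots> = (b / a) * (cmod z)\<^sup>2 + (a / b) * (cmod w)\<^sup>2 - 2 * cmod z * cmod w"
      using assms by (simp add: field_simps power2_eq_square)
    finally show ?thesis by simp
  qed
  moreover have "(cmod (z + w))\<^sup>2 \<le> (cmod z + cmod w)\<^sup>2"
    by (intro power_mono norm_triangle_ineq) auto
  ultimately show ?thesis
    by (simp add: power2_sum algebra_simps)
qed

lemma L2_functions_add:
  assumes f: "f \<in> L2_functions M" and g: "g \<in> L2_functions M"
  shows "(\<lambda>x. f x + g x) \<in> L2_functions M"
proof -
  have [measurable]: "f \<in> borel_measurable M" "g \<in> borel_measurable M"
    using f g by (auto simp: L2_functions_def)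
  have "integrable M (\<lambda>x. 2 * (cmod (f x))\<^sup>2 + 2 * (cmod (g x))\<^sup>2)"
    using f g by (auto simp: L2_functions_def)
  then have "integrable M (\<lambda>x. (cmod (f x + g x))\<^sup>2)"
  proof (rule Bochner_Integration.integrable_bound)
    show "AE x in M. norm ((cmod (f x + g x))\<^sup>2)
            \<le> norm (2 * (cmod (f x))\<^sup>2 + 2 * (cmod (g x))\<^sup>2)"
      using cmod_add_sq_le[of 1 1] by auto
  qed measurable
  then show ?thesis by (simp add: L2_functions_def)
qed

lemma L2_functions_diff:
  assumes "f \<in> L2_functions M" and "g \<in> L2_functions M"
  shows "(\<lambda>x. f x - g x) \<in> L2_functions M"
  using L2_functions_add[OF assms(1), of "\<lambda>x. - g x"] assms(2)
  by (auto simp: L2_functions_def)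

lemma L2_norm_triangle:
  assumes f: "f \<in> L2_functions M" and g: "g \<in> L2_functions M"
  shows "L2_norm M (\<lambda>x. f x + g x) \<le> L2_norm M f + L2_norm M g"
proof (rule field_le_epsilon)
  fix e :: real assume e: "e > 0"
  define a where "a = L2_norm M f + e / 2"
  define b where "b = L2_norm M g + e / 2"
  have ab: "a > 0" "b > 0"
    using e L2_norm_nonneg[of M f] L2_norm_nonneg[of M g] by (auto simp: a_def b_def)
  have int: "integrable M (\<lambda>x. (cmod (f x))\<^sup>2)" "integrable M (\<lambda>x. (cmod (g x))\<^sup>2)"
    "integrable M (\<lambda>x. (cmod (f x + g x))\<^sup>2)"
    using f g L2_functions_add[OF f g] by (auto simp: L2_functions_def)
  have "sqrt (\<integral>x. (cmod (f x))\<^sup>2 \<partial>M) \<le> a" "sqrt (\<integral>x. (cmod (g x))\<^sup>2 \<partial>M) \<le> b"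
    using e by (auto simp: a_def b_def L2_norm_def)
  then have le: "(\<integral>x. (cmod (f x))\<^sup>2 \<partial>M) \<le> a\<^sup>2" "(\<integral>x. (cmod (g x))\<^sup>2 \<partial>M) \<le> b\<^sup>2"
    using sqrt_le_D by blast+
  have "(\<integral>x. (cmod (f x + g x))\<^sup>2 \<partial>M)
      \<le> (\<integral>x. (1 + b / a) * (cmod (f x))\<^sup>2 + (1 + a / b) * (cmod (g x))\<^sup>2 \<partial>M)"
    using int ab by (intro integral_mono cmod_add_sq_le) auto
  also have "\<dots> = (1 + b / a) * (\<integral>x. (cmod (f x))\<^sup>2 \<partial>M) + (1 + a / b) * (\<integral>x. (cmod (g x))\<^sup>2 \<partial>M)"
    using int by simp
  also have "\<dots> \<le> (1 + b / a) * a\<^sup>2 + (1 + a / b) * b\<^sup>2"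
    using le ab by (intro add_mono mult_left_mono) auto
  also have "\<dots> = (a + b)\<^sup>2"
    using ab by (simp add: field_simps power2_eq_square)
  finally have "L2_norm M (\<lambda>x. f x + g x) \<le> a + b"
    using ab by (simp add: L2_norm_def real_le_lsqrt)
  then show "L2_norm M (\<lambda>x. f x + g x) \<le> L2_norm M f + L2_norm M g + e"
    by (simp add: a_def b_def)
qed

lemma equiv_ae_equal: "equiv (L2_functions M) (ae_equal M)"
proof (rule equivI)
  show "trans (ae_equal M)"
  proof (rule transI)
    fix f g h assume "(f, g) \<in> ae_equal M" "(g, h) \<in> ae_equal M"
    then show "(f, h) \<in> ae_equal M"
      by (auto simp: ae_equal_def elim: AE_mp)
  qed
qed (auto simp: ae_equal_def refl_on_def sym_def eq_commute)

lemma L2_dist_class: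
  assumes f: "f \<in> L2_functions M" and g: "g \<in> L2_functions M"
  shows "L2_dist M (L2_class M f) (L2_class M g) = L2_norm M (\<lambda>x. f x - g x)"
proof -
  define f' where "f' = (SOME k. k \<in> L2_class M f)"
  define g' where "g' = (SOME k. k \<in> L2_class M g)"
  have "f' \<in> L2_class M f" "g' \<in> L2_class M g"
    unfolding f'_def g'_def L2_class_def
    using someI[of "\<lambda>k. k \<in> ae_equal M `` {f}", OF equiv_class_self[OF equiv_ae_equal f]]
      someI[of "\<lambda>k. k \<in> ae_equal M `` {g}", OF equiv_class_self[OF equiv_ae_equal g]]
    by blast+
  then have *: "f' \<in> L2_functions M" "g' \<in> L2_functions M"
      "AE x in M. f x = f' x" "AE x in M. g x = g' x"
    by (auto simp: L2_class_def ae_equal_def)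
  have "L2_norm M (\<lambda>x. f' x - g' x) = L2_norm M (\<lambda>x. f x - g x)"
  proof (rule L2_norm_cong)
    show "AE x in M. f' x - g' x = f x - g x"
      using *(3,4) by eventually_elim simp
  qed (use * f g in \<open>auto simp: L2_functions_def\<close>)
  then show ?thesis by (simp add: L2_dist_def f'_def g'_def)
qed

lemma L2_space_classE:
  assumes "A \<in> L2_space M"
  obtains f where "f \<in> L2_functions M" "A = L2_class M f"
  using assms by (auto simp: L2_space_def L2_class_def elim: quotientE)

lemma Metric_space_L2: "Metric_space (L2_space M) (L2_dist M)"
proof
  fix A B show "0 \<le> L2_dist M A B" by (simp add: L2_dist_def L2_norm_nonneg)
next
  fix A B show "L2_dist M A B = L2_dist M B A"
    by (simp add: L2_dist_def L2_norm_def norm_minus_commute)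
next
  fix A B assume "A \<in> L2_space M" "B \<in> L2_space M"
  then obtain f g where fg: "f \<in> L2_functions M" "A = L2_class M f"
      "g \<in> L2_functions M" "B = L2_class M g"
    by (metis L2_space_classE)
  have int: "integrable M (\<lambda>x. (cmod (f x - g x))\<^sup>2)"
    using L2_functions_diff[OF fg(1,3)] by (simp add: L2_functions_def)
  have "L2_dist M A B = 0 \<longleftrightarrow> (\<integral>x. (cmod (f x - g x))\<^sup>2 \<partial>M) = 0"
    using fg by (simp add: L2_dist_class L2_norm_def)
  also have "\<dots> \<longleftrightarrow> (AE x in M. (cmod (f x - g x))\<^sup>2 = 0)"
    by (rule integral_nonneg_eq_0_iff_AE[OF int]) auto
  also have "\<dots> \<longleftrightarrow> (f, g) \<in> ae_equal M"
    using fg by (simp add: ae_equal_def)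
  also have "\<dots> \<longleftrightarrow> A = B"
    using eq_equiv_class_iff[OF equiv_ae_equal fg(1,3)] fg by (simp add: L2_class_def)
  finally show "L2_dist M A B = 0 \<longleftrightarrow> A = B" .
next
  fix A B C assume "A \<in> L2_space M" "B \<in> L2_space M" "C \<in> L2_space M"
  then obtain f g h where fg: "f \<in> L2_functions M" "A = L2_class M f"
      "g \<in> L2_functions M" "B = L2_class M g" "h \<in> L2_functions M" "C = L2_class M h"
    by (metis L2_space_classE)
  show "L2_dist M A C \<le> L2_dist M A B + L2_dist M B C"
    using L2_norm_triangle[OF L2_functions_diff[OF fg(1,3)] L2_functions_diff[OF fg(3,5)]] fg
    by (simp add: L2_dist_class)
qed


section \<open>Almost periodic functions\<close>

text \<open>Precompact means relatively compact: the closure of the orbit is compact.\<close>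

definition almost_periodic ::
  "('g, 'b) monoid_scheme \<Rightarrow> ('g \<Rightarrow> 'x \<Rightarrow> 'x) \<Rightarrow> 'x measure \<Rightarrow> ('x \<Rightarrow> complex) \<Rightarrow> bool" where
  "almost_periodic G \<phi> \<mu> f \<longleftrightarrow>
     f \<in> L2_functions \<mu> \<and>
     compactin (L2_topology \<mu>)
       (L2_topology \<mu> closure_of ((\<lambda>g. L2_class \<mu> (f \<circ> \<phi> g)) ` carrier G))"


section \<open>Bounded complexity\<close>

definition mean_semimetric ::
  "('g \<Rightarrow> 'x \<Rightarrow> 'x) \<Rightarrow> ('x \<Rightarrow> 'x \<Rightarrow> real) \<Rightarrow> 'g set \<Rightarrow> 'x \<Rightarrow> 'x \<Rightarrow> real" where
  "mean_semimetric \<phi> w F x y = (\<Sum>g\<in>F. w (\<phi> g x) (\<phi> g y)) / real (card F)"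

definition semimetric_ball :: "('x \<Rightarrow> 'x \<Rightarrow> real) \<Rightarrow> 'x \<Rightarrow> real \<Rightarrow> 'x set" where
  "semimetric_ball w x r = {y. w x y < r}"

text \<open>
  The minimum is taken in the extended naturals, so that it is \<open>\<infinity>\<close> (and not some junk number)
  in case no finite family of balls has large enough measure.
\<close>

definition complexity :: "'x measure \<Rightarrow> ('x \<Rightarrow> 'x \<Rightarrow> real) \<Rightarrow> real \<Rightarrow> enat" where
  "complexity \<mu> w \<epsilon> =
     Inf (enat ` {m. \<exists>x :: nat \<Rightarrow> 'x.
                       measure \<mu> (\<Union>i\<in>{1..m}. semimetric_ball w (x i) (\<epsilon> / 2)) > 1 - \<epsilon>})"

definition bounded_complexity :: "'x measure \<Rightarrow> (nat \<Rightarrow> 'x \<Rightarrow> 'x \<Rightarrow> real) \<Rightarrow> bool" where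
  "bounded_complexity \<mu> w \<longleftrightarrow>
     (\<forall>\<epsilon>>0. \<exists>M :: nat. \<forall>n. complexity \<mu> (w n) \<epsilon> \<le> enat M)"

end

theory Submission
  imports Defs
begin

text \<open>
  Write \<open>h \<circ> g\<close> for the function \<open>x \<mapsto> h (\<phi> g x)\<close>. As \<open>L\<^sup>2\<close> is complete, almost periodicity of
  \<open>h\<close> means that the orbit \<open>{h \<circ> g}\<close> is totally bounded (\<open>orbit_totally_bounded_iff\<close>), so the
  theorem compares two kinds of finite approximation of the array \<open>h (\<phi> g x)\<close>: a finite net for
  the rows \<open>g\<close>, uniformly in the \<open>L\<^sup>2\<close> sense, and for each \<open>n\<close> a net of bounded size for the
  columns \<open>x\<close>, up to a set of small measure and averaged over \<open>g \<in> F n\<close>. In both directions a net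
  for one side is turned into one for the other by colouring: each object is labelled by the
  approximate values that it takes along the given net, and the number of labels depends only on
  the size of the net and on the precision.

  Suppose first that the orbit has a finite net \<open>K\<close>. Averaged over \<open>g \<in> F n\<close>, each \<open>h \<circ> g\<close> may be
  replaced by its neighbour in the net, with an error that is small off a small set by Markov's
  inequality. Two points \<open>x\<close>, \<open>y\<close> for which the vectors \<open>(h (\<phi> k x))\<close> and \<open>(h (\<phi> k y))\<close>,
  \<open>k \<in> K\<close>, have the same label are then close in the mean semimetric, and one point for each label
  suffices (\<open>almost_periodic_imp_bounded_complexity\<close>).

  Conversely, assume bounded complexity. Clipping the values of \<open>h\<close> to a large disc changes the
  orbit little in \<open>L\<^sup>2\<close> and does not increase the complexities, so that \<open>h\<close> may be taken bounded.
  Labelling \<open>g\<close> by the approximate values of \<open>h \<circ> g\<close> at the centres of the balls shows that at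
  least three quarters of \<open>F n\<close> carry at most \<open>N\<close> labels, with functions of the same label close in
  \<open>L\<^sup>1\<close>, where \<open>N\<close> does not depend on \<open>n\<close> (\<open>bounded_complexity_colouring\<close>). This controls only
  \<^emph>\<open>most\<close> elements of each \<open>F n\<close>, but the distance between \<open>h \<circ> s\<close> and \<open>h \<circ> t\<close> equals that between
  \<open>h \<circ> (s k)\<close> and \<open>h \<circ> (t k)\<close>, as \<open>\<mu>\<close> is invariant. Given any finite set \<open>T\<close>, the Folner property
  yields an \<open>n\<close> and a \<open>k\<close> for which at least half of the \<open>t k\<close>, \<open>t \<in> T\<close>, lie in the good part of
  \<open>F n\<close> (\<open>Folner_half_of_translates\<close>). By the pigeonhole principle a separated set \<open>T\<close> has at most
  \<open>2 * N\<close> elements, and a separated set of maximal size is a net.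
\<close>

section \<open>Square-integrable functions on a probability space\<close>

lemma L2_functions_integrable_sq: "f \<in> L2_functions M \<Longrightarrow> integrable M (\<lambda>x. (cmod (f x))\<^sup>2)"
  by (simp add: L2_functions_def)

lemma L2_functions_measurable: "f \<in> L2_functions M \<Longrightarrow> f \<in> borel_measurable M"
  by (simp add: L2_functions_def)

lemma (in prob_space) bounded_in_L2_functions:
  assumes "f \<in> borel_measurable M" and "\<And>x. cmod (f x) \<le> R"
  shows "f \<in> L2_functions M"
proof -
  have "integrable M (\<lambda>x. (cmod (f x))\<^sup>2)"
    using assms by (intro integrable_const_bound[where B="R\<^sup>2"]) (auto intro!: power_mono)
  then show ?thesis using assms by (simp add: L2_functions_def)
qed

lemma (in prob_space) L2_functions_integrable:
  assumes "f \<in> L2_functions M"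
  shows "integrable M f"
proof (rule Bochner_Integration.integrable_bound)
  show "integrable M (\<lambda>x. 1 + (cmod (f x))\<^sup>2)"
    using assms by (simp add: L2_functions_def)
  have "t \<le> 1 + t\<^sup>2" for t :: real
    using zero_le_power2[of "t - 1/2"] by (simp add: power2_eq_square algebra_simps)
  then show "AE x in M. cmod (f x) \<le> norm (1 + (cmod (f x))\<^sup>2)"
    by simp
qed (use assms in \<open>simp add: L2_functions_def\<close>)

lemma (in prob_space) expectation_le_L2_norm:
  assumes "f \<in> L2_functions M"
  shows "expectation (\<lambda>x. cmod (f x)) \<le> L2_norm M f"
proof -
  have "(expectation (\<lambda>x. cmod (f x)))\<^sup>2 \<le> expectation (\<lambda>x. (cmod (f x))\<^sup>2)"
    using variance_eq[of "\<lambda>x. cmod (f x)"] variance_positive[of "\<lambda>x. cmod (f x)"]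
      integrable_norm[OF L2_functions_integrable[OF assms]] L2_functions_integrable_sq[OF assms]
    by linarith
  then show ?thesis unfolding L2_norm_def by (rule real_le_rsqrt)
qed

text \<open>
  On uniformly bounded functions, smallness in \<open>L\<^sup>1\<close> forces smallness in \<open>L\<^sup>2\<close>; this converts the
  averages of absolute values in the mean semimetric back to the norm in which orbits are measured.
\<close>

lemma (in prob_space) L2_norm_sq_le_expectation:
  assumes "f \<in> borel_measurable M" and "\<And>x. cmod (f x) \<le> B"
  shows "(L2_norm M f)\<^sup>2 \<le> B * expectation (\<lambda>x. cmod (f x))"
proof -
  have f: "f \<in> L2_functions M"
    using assms by (rule bounded_in_L2_functions)
  have "(L2_norm M f)\<^sup>2 = expectation (\<lambda>x. (cmod (f x))\<^sup>2)"
    unfolding L2_norm_def by simp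
  also have "\<dots> \<le> expectation (\<lambda>x. B * cmod (f x))"
  proof (intro integral_mono)
    show "integrable M (\<lambda>x. B * cmod (f x))"
      using L2_functions_integrable[OF f] by simp
    show "(cmod (f x))\<^sup>2 \<le> B * cmod (f x)" for x
      unfolding power2_eq_square using assms(2)[of x] by (intro mult_right_mono) auto
  qed (rule L2_functions_integrable_sq[OF f])
  finally show ?thesis by simp
qed

lemma L2_norm_diff_commute: "L2_norm M (\<lambda>x. f x - g x) = L2_norm M (\<lambda>x. g x - f x)"
  by (simp add: L2_norm_def norm_minus_commute)

lemma L2_norm_diff_triangle:
  assumes "f \<in> L2_functions M" "g \<in> L2_functions M" "k \<in> L2_functions M"
  shows "L2_norm M (\<lambda>x. f x - k x) \<le> L2_norm M (\<lambda>x. f x - g x) + L2_norm M (\<lambda>x. g x - k x)"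
  using L2_norm_triangle[OF L2_functions_diff[OF assms(1,2)] L2_functions_diff[OF assms(2,3)]]
  by simp

text \<open>
  Fatou's lemma applied to the squares.
\<close>

lemma L2_norm_le_of_AE_limit:
  assumes u: "\<And>i. u i \<in> L2_functions M" and f: "f \<in> borel_measurable M"
    and lim: "AE x in M. (\<lambda>i::nat. u i x) \<longlonglongrightarrow> f x"
    and le: "eventually (\<lambda>i. L2_norm M (u i) \<le> e) sequentially"
  shows "f \<in> L2_functions M" and "L2_norm M f \<le> e"
proof -
  have [measurable]: "u i \<in> borel_measurable M" for i
    using u by (simp add: L2_functions_def)
  have [measurable]: "f \<in> borel_measurable M" by (rule f)
  have "(\<integral>\<^sup>+x. ennreal ((cmod (f x))\<^sup>2) \<partial>M) = (\<integral>\<^sup>+x. liminf (\<lambda>i. ennreal ((cmod (u i x))\<^sup>2)) \<partial>M)"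
  proof (rule nn_integral_cong_AE)
    show "AE x in M. ennreal ((cmod (f x))\<^sup>2) = liminf (\<lambda>i. ennreal ((cmod (u i x))\<^sup>2))"
      using lim
    proof eventually_elim
      fix x assume "(\<lambda>i. u i x) \<longlonglongrightarrow> f x"
      then have "(\<lambda>i. ennreal ((cmod (u i x))\<^sup>2)) \<longlonglongrightarrow> ennreal ((cmod (f x))\<^sup>2)"
        by (intro tendsto_ennrealI tendsto_intros)
      then show "ennreal ((cmod (f x))\<^sup>2) = liminf (\<lambda>i. ennreal ((cmod (u i x))\<^sup>2))"
        by (intro lim_imp_Liminf[symmetric]) auto
    qed
  qed
  also have "\<dots> \<le> liminf (\<lambda>i. \<integral>\<^sup>+x. ennreal ((cmod (u i x))\<^sup>2) \<partial>M)"
    by (rule nn_integral_liminf) measurable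
  also have "\<dots> \<le> limsup (\<lambda>i. \<integral>\<^sup>+x. ennreal ((cmod (u i x))\<^sup>2) \<partial>M)"
    by (rule Liminf_le_Limsup) simp
  also have "\<dots> \<le> ennreal (e\<^sup>2)"
  proof (rule Limsup_bounded)
    show "eventually (\<lambda>i. (\<integral>\<^sup>+x. ennreal ((cmod (u i x))\<^sup>2) \<partial>M) \<le> ennreal (e\<^sup>2)) sequentially"
      using le
    proof eventually_elim
      fix i assume "L2_norm M (u i) \<le> e"
      then have "(\<integral>x. (cmod (u i x))\<^sup>2 \<partial>M) \<le> e\<^sup>2"
        unfolding L2_norm_def by (rule sqrt_le_D)
      then show "(\<integral>\<^sup>+x. ennreal ((cmod (u i x))\<^sup>2) \<partial>M) \<le> ennreal (e\<^sup>2)"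
        using L2_functions_integrable_sq[OF u] by (subst nn_integral_eq_integral) (auto intro: ennreal_leI)
    qed
  qed
  finally have *: "(\<integral>\<^sup>+x. ennreal ((cmod (f x))\<^sup>2) \<partial>M) \<le> ennreal (e\<^sup>2)" .
  then have int: "integrable M (\<lambda>x. (cmod (f x))\<^sup>2)"
    by (intro integrableI_nonneg) (auto simp: less_top[symmetric] top_unique)
  then show "f \<in> L2_functions M"
    by (simp add: L2_functions_def)
  have "(\<integral>x. (cmod (f x))\<^sup>2 \<partial>M) \<le> e\<^sup>2"
    using * int by (subst (asm) nn_integral_eq_integral) (auto simp: ennreal_le_iff)
  moreover have "0 \<le> e"
    using eventually_happens'[OF _ le] L2_norm_nonneg order_trans by (metis sequentially_bot)
  ultimately show "L2_norm M f \<le> e"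
    unfolding L2_norm_def by (intro real_le_lsqrt) auto
qed

lemma L2_class_in_L2_space: "f \<in> L2_functions M \<Longrightarrow> L2_class M f \<in> L2_space M"
  by (simp add: L2_space_def L2_class_def quotientI)

text \<open>
  The Riesz-Fischer theorem. On a probability space an \<open>L\<^sup>2\<close>-Cauchy sequence is Cauchy in \<open>L\<^sup>1\<close> and
  so has a subsequence that converges almost everywhere; Fatou's lemma, applied to the differences
  with a fixed late term, shows that the pointwise limit is also the limit in \<open>L\<^sup>2\<close>.
\<close>

theorem (in prob_space) L2_complete:
  "Metric_space.mcomplete (L2_space M) (L2_dist M)"
proof -
  interpret L2: Metric_space "L2_space M" "L2_dist M" by (rule Metric_space_L2)
  show ?thesis
    unfolding L2.mcomplete_def
  proof (intro allI impI)
    fix \<sigma> assume \<sigma>: "L2.MCauchy \<sigma>"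
    have "\<exists>f. f \<in> L2_functions M \<and> \<sigma> n = L2_class M f" for n
      using \<sigma> by (meson L2.MCauchy_def L2_space_classE rangeI subsetD)
    then obtain s where s: "\<And>n. s n \<in> L2_functions M" and \<sigma>s: "\<And>n. \<sigma> n = L2_class M (s n)"
      by metis
    have [measurable]: "s n \<in> borel_measurable M" for n
      using s by (rule L2_functions_measurable)
    have cauchy: "\<exists>N. \<forall>i\<ge>N. \<forall>j\<ge>N. L2_norm M (\<lambda>x. s i x - s j x) < e" if "e > 0" for e
      using \<sigma> that unfolding L2.MCauchy_def by (metis \<sigma>s L2_dist_class s)
    have "\<exists>N. \<forall>i\<ge>N. \<forall>j\<ge>N. expectation (\<lambda>x. cmod (s i x - s j x)) < e" if "e > 0" for e
      using cauchy[OF that] expectation_le_L2_norm[OF L2_functions_diff[OF s s]]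
      by (meson order.strict_trans1)
    then obtain r where r: "strict_mono r" and "AE x in M. Cauchy (\<lambda>i. s (r i) x)"
      using cauchy_L1_AE_cauchy_subseq[of M s, OF L2_functions_integrable[OF s]] by metis
    then have lim: "AE x in M. (\<lambda>i. s (r i) x) \<longlonglongrightarrow> lim (\<lambda>i. s (r i) x)"
      by (auto simp: Cauchy_convergent_iff convergent_LIMSEQ_iff)
    define f where "f x = lim (\<lambda>i. s (r i) x)" for x
    have f_meas [measurable]: "f \<in> borel_measurable M"
      unfolding f_def by measurable
    have close: "(\<lambda>x. f x - s n x) \<in> L2_functions M \<and> L2_norm M (\<lambda>x. f x - s n x) \<le> e"
      if N: "\<And>i j. i \<ge> N \<Longrightarrow> j \<ge> N \<Longrightarrow> L2_norm M (\<lambda>x. s i x - s j x) < e" and "n \<ge> N" for n N e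
    proof -
      have "AE x in M. (\<lambda>i. s (r i) x - s n x) \<longlonglongrightarrow> f x - s n x"
        using lim by eventually_elim (auto simp: f_def intro: tendsto_diff)
      moreover have "eventually (\<lambda>i. L2_norm M (\<lambda>x. s (r i) x - s n x) \<le> e) sequentially"
        using eventually_ge_at_top[of N]
      proof eventually_elim
        fix i assume "i \<ge> N"
        then have "r i \<ge> N" using seq_suble[OF r, of i] by simp
        then show "L2_norm M (\<lambda>x. s (r i) x - s n x) \<le> e"
          using N[of "r i" n] \<open>n \<ge> N\<close> by simp
      qed
      ultimately show ?thesis
        using L2_norm_le_of_AE_limit[of "\<lambda>i x. s (r i) x - s n x" M "\<lambda>x. f x - s n x" e]
          L2_functions_diff[OF s s] by auto
    qed
    have f: "f \<in> L2_functions M"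
    proof -
      obtain N where "\<forall>i\<ge>N. \<forall>j\<ge>N. L2_norm M (\<lambda>x. s i x - s j x) < 1"
        using cauchy[of 1] by auto
      then have "(\<lambda>x. f x - s N x) \<in> L2_functions M"
        using close[of N 1 N] by auto
      from L2_functions_add[OF this s[of N]] show ?thesis by simp
    qed
    have "limitin L2.mtopology \<sigma> (L2_class M f) sequentially"
      unfolding L2.limitin_metric
    proof (intro conjI allI impI)
      show "L2_class M f \<in> L2_space M" using f by (rule L2_class_in_L2_space)
      fix e :: real assume "e > 0"
      then obtain N where N: "\<forall>i\<ge>N. \<forall>j\<ge>N. L2_norm M (\<lambda>x. s i x - s j x) < e/2"
        using cauchy[of "e/2"] by auto
      show "eventually (\<lambda>n. \<sigma> n \<in> L2_space M \<and> L2_dist M (\<sigma> n) (L2_class M f) < e) sequentially"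
        using eventually_ge_at_top[of N]
      proof eventually_elim
        fix n assume "n \<ge> N"
        then have "L2_norm M (\<lambda>x. f x - s n x) \<le> e/2"
          using close[of N "e/2" n] N by auto
        then show "\<sigma> n \<in> L2_space M \<and> L2_dist M (\<sigma> n) (L2_class M f) < e"
          using \<open>e > 0\<close> s f
          by (simp add: \<sigma>s L2_dist_class L2_class_in_L2_space L2_norm_diff_commute[of M "s n"])
      qed
    qed
    then show "\<exists>x. limitin L2.mtopology \<sigma> x sequentially" by blast
  qed
qed

section \<open>Clipping unbounded functions\<close>

definition clip :: "real \<Rightarrow> complex \<Rightarrow> complex" where
  "clip R = closest_point (cball 0 R)"

lemma clip_lipschitz:
  "0 \<le> R \<Longrightarrow> cmod (clip R z - clip R w) \<le> cmod (z - w)"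
  using closest_point_lipschitz[of "cball 0 R" z w] by (simp add: clip_def dist_norm)

lemma norm_clip_le: "0 \<le> R \<Longrightarrow> cmod (clip R z) \<le> R"
  using closest_point_in_set[of "cball 0 R" z] by (simp add: clip_def)

lemma clip_eq_self: "cmod z \<le> R \<Longrightarrow> clip R z = z"
  by (simp add: clip_def closest_point_self)

lemma norm_clip_diff_le: "0 \<le> R \<Longrightarrow> cmod (z - clip R z) \<le> cmod z"
  using closest_point_le[of "cball 0 R" 0 z] by (simp add: clip_def dist_norm)

lemma clip_measurable [measurable]: "0 \<le> R \<Longrightarrow> clip R \<in> borel_measurable borel"
  unfolding clip_def
  by (intro borel_measurable_continuous_onI continuous_on_closest_point) auto

text \<open>
  For each point, the clipped value is the original one as soon as \<open>R\<close> is large; the errors are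
  dominated by \<open>f\<close> itself.
\<close>

lemma L2_approx_by_clip:
  assumes f: "f \<in> L2_functions M" and "e > 0"
  obtains R where "R > 0" "L2_norm M (\<lambda>x. f x - clip R (f x)) < e"
proof -
  have [measurable]: "f \<in> borel_measurable M" by (rule L2_functions_measurable[OF f])
  have [measurable]: "clip (real n) \<in> borel_measurable borel" for n
    by (rule clip_measurable) simp
  have "(\<lambda>n. \<integral>x. (cmod (f x - clip (real n) (f x)))\<^sup>2 \<partial>M) \<longlonglongrightarrow> (\<integral>x. 0 \<partial>M)"
  proof (rule integral_dominated_convergence[where w="\<lambda>x. (cmod (f x))\<^sup>2"])
    show "integrable M (\<lambda>x. (cmod (f x))\<^sup>2)" by (rule L2_functions_integrable_sq[OF f])
    have "(\<lambda>n. (cmod (f x - clip (real n) (f x)))\<^sup>2) \<longlonglongrightarrow> 0" for x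
    proof (rule tendsto_eventually)
      obtain N where "cmod (f x) \<le> real N" using real_arch_simple by blast
      then show "eventually (\<lambda>n. (cmod (f x - clip (real n) (f x)))\<^sup>2 = 0) sequentially"
        unfolding eventually_sequentially
        by (intro exI[of _ N]) (simp add: clip_eq_self order_trans)
    qed
    then show "AE x in M. (\<lambda>n. (cmod (f x - clip (real n) (f x)))\<^sup>2) \<longlonglongrightarrow> 0" by simp
    show "AE x in M. norm ((cmod (f x - clip (real n) (f x)))\<^sup>2) \<le> (cmod (f x))\<^sup>2" for n
      by (auto intro!: power_mono norm_clip_diff_le)
  qed measurable
  then have "(\<lambda>n. L2_norm M (\<lambda>x. f x - clip (real n) (f x))) \<longlonglongrightarrow> 0"
    unfolding L2_norm_def using tendsto_real_sqrt by fastforce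
  then have "eventually (\<lambda>n. L2_norm M (\<lambda>x. f x - clip (real n) (f x)) < e) sequentially"
    using \<open>e > 0\<close> by (rule order_tendstoD)
  with eventually_gt_at_top[of 0]
  have "eventually (\<lambda>n. 0 < n \<and> L2_norm M (\<lambda>x. f x - clip (real n) (f x)) < e) sequentially"
    by eventually_elim simp
  then obtain n where "0 < n" "L2_norm M (\<lambda>x. f x - clip (real n) (f x)) < e"
    using eventually_happens'[OF sequentially_bot] by auto
  then show ?thesis using that[of "real n"] by simp
qed

section \<open>Covering numbers\<close>

text \<open>
  Here \<open>m\<close> need not be \<open>M\<close>: the minimum defining the complexity is attained whenever it is finite.
\<close>

lemma complexity_le_iff:
  "complexity \<mu> w \<epsilon> \<le> enat M \<longleftrightarrow>
   (\<exists>m\<le>M. \<exists>x::nat \<Rightarrow> 'x. measure \<mu> (\<Union>i\<in>{1..m}. semimetric_ball w (x i) (\<epsilon> / 2)) > 1 - \<epsilon>)"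
  for \<mu> :: "'x measure"
proof -
  define A where "A = {m. \<exists>x :: nat \<Rightarrow> 'x.
      measure \<mu> (\<Union>i\<in>{1..m}. semimetric_ball w (x i) (\<epsilon> / 2)) > 1 - \<epsilon>}"
  have "Inf (enat ` A) \<le> enat M \<longleftrightarrow> (\<exists>m\<le>M. m \<in> A)"
  proof
    assume *: "Inf (enat ` A) \<le> enat M"
    then have "enat ` A \<noteq> {}" by (auto simp: Inf_enat_def)
    then have "Inf (enat ` A) \<in> enat ` A" by (auto simp: Inf_enat_def intro: LeastI)
    with * show "\<exists>m\<le>M. m \<in> A" by auto
  next
    assume "\<exists>m\<le>M. m \<in> A"
    then show "Inf (enat ` A) \<le> enat M" by (meson Inf_lower2 enat_ord_simps(1) imageI)
  qed
  then show ?thesis by (auto simp: complexity_def A_def)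
qed

lemma complexity_le_of_finite_cover:
  assumes "finite S" "card S \<le> M"
    and "measure \<mu> (\<Union>x\<in>S. semimetric_ball w x (\<epsilon> / 2)) > 1 - \<epsilon>"
  shows "complexity \<mu> w \<epsilon> \<le> enat M"
proof -
  obtain x where x: "x ` {1..card S} = S"
    using ex_bij_betw_nat_finite_1[OF assms(1)] bij_betw_imp_surj_on by blast
  have "(\<Union>i\<in>{1..card S}. semimetric_ball w (x i) (\<epsilon> / 2))
      = (\<Union>y\<in>x ` {1..card S}. semimetric_ball w y (\<epsilon> / 2))"
    by simp
  also have "\<dots> = (\<Union>y\<in>S. semimetric_ball w y (\<epsilon> / 2))"
    by (simp only: x)
  finally show ?thesis
    unfolding complexity_le_iff using assms by (intro exI[of _ "card S"] conjI exI[of _ x]) auto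
qed

text \<open>
  The map \<open>q\<close> rounds a value to a point of the net; composed with finitely many evaluations, it
  gives the labels that are used in both directions of the theorem.
\<close>

lemma finite_net_cball:
  fixes R \<epsilon> :: real assumes "\<epsilon> > 0"
  obtains C :: "complex set" and q where "finite C"
    "\<And>z. cmod z \<le> R \<Longrightarrow> q z \<in> C" "\<And>z. cmod z \<le> R \<Longrightarrow> cmod (z - q z) < \<epsilon>"
proof -
  have "\<exists>C. finite C \<and> cball (0::complex) R \<subseteq> (\<Union>c\<in>C. ball c \<epsilon>)"
    using conjunct2[OF compact_cball[of "0::complex" R, unfolded compact_eq_totally_bounded]] assms
    by (elim allE impE)
  then obtain C where C: "finite C" "cball (0::complex) R \<subseteq> (\<Union>c\<in>C. ball c \<epsilon>)"
    by (elim exE conjE)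
  have "\<exists>c. cmod z \<le> R \<longrightarrow> c \<in> C \<and> cmod (z - c) < \<epsilon>" for z
  proof (cases "cmod z \<le> R")
    case True
    then have "z \<in> (\<Union>c\<in>C. ball c \<epsilon>)" using C(2) by (intro subsetD[OF C(2)]) simp
    then show ?thesis by (auto simp: dist_norm norm_minus_commute)
  qed auto
  then obtain q where "\<And>z. cmod z \<le> R \<longrightarrow> q z \<in> C \<and> cmod (z - q z) < \<epsilon>" by metis
  then show ?thesis using that[OF C(1), of q] by blast
qed

section \<open>Translating a finite set into a large part of a Folner set\<close>

text \<open>
  If \<open>F n\<close> is nearly invariant under every \<open>t \<in> T\<close>, then \<open>t \<otimes> k\<close> leaves \<open>F n\<close> for at most a
  quarter of the \<open>k \<in> F n\<close> and falls into \<open>F n - A n\<close> for at most another quarter, so that it misses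
  \<open>A n\<close> for at most half of them. Averaging over \<open>k\<close> gives one \<open>k\<close>
  that is good for half of \<open>T\<close>. One cannot ask for a \<open>k\<close> that is good for all of \<open>T\<close>: for that, the
  exceptional fraction would have to be small compared with \<open>1 / card T\<close>, while in the application
  \<open>T\<close> outnumbers a set of colours that itself grows as this fraction shrinks.
\<close>

lemma (in group) Folner_half_of_translates:
  assumes F: "Folner_sequence G F"
    and A: "\<And>n. A n \<subseteq> F n" "\<And>n. 4 * card (F n - A n) \<le> card (F n)"
    and T: "finite T" "T \<subseteq> carrier G"
  obtains n k where "k \<in> F n" "card T \<le> 2 * card {t \<in> T. t \<otimes> k \<in> A n}"
proof -
  have Fn: "F n \<subseteq> carrier G" "finite (F n)" "F n \<noteq> {}" for n
    using F by (auto simp: Folner_sequence_def)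
  have "eventually (\<lambda>n. \<forall>t\<in>T. real (card (sym_diff (t <# F n) (F n))) / real (card (F n)) < 1/4)
      sequentially"
  proof (intro eventually_ball_finite[OF T(1)] ballI)
    fix t assume "t \<in> T"
    then have "(\<lambda>n. real (card (sym_diff (t <# F n) (F n))) / real (card (F n))) \<longlonglongrightarrow> 0"
      using F T(2) by (auto simp: Folner_sequence_def)
    then show "eventually (\<lambda>n. real (card (sym_diff (t <# F n) (F n))) / real (card (F n)) < 1/4)
        sequentially"
      by (rule order_tendstoD) simp
  qed
  then obtain n where n: "\<And>t. t \<in> T \<Longrightarrow> real (card (sym_diff (t <# F n) (F n))) / real (card (F n)) < 1/4"
    using eventually_happens'[OF sequentially_bot] by blast
  have pos: "card (F n) > 0" using Fn[of n] by (simp add: card_gt_0_iff)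
  have bad: "2 * card {k \<in> F n. t \<otimes> k \<notin> A n} \<le> card (F n)" if t: "t \<in> T" for t
  proof -
    have tG: "t \<in> carrier G" using t T by auto
    have fin: "finite (sym_diff (t <# F n) (F n))"
      using Fn[of n] by (auto simp: l_coset_def)
    have "inj_on (\<lambda>k. t \<otimes> k) {k \<in> F n. t \<otimes> k \<notin> A n}"
      using Fn(1)[of n] by (intro inj_on_subset[OF inj_on_cmult[OF tG]]) auto
    then have "card {k \<in> F n. t \<otimes> k \<notin> A n} = card ((\<lambda>k. t \<otimes> k) ` {k \<in> F n. t \<otimes> k \<notin> A n})"
      by (simp add: card_image)
    also have "\<dots> \<le> card (sym_diff (t <# F n) (F n) \<union> (F n - A n))"
      using Fn[of n] fin by (intro card_mono) (auto simp: l_coset_def)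
    also have "\<dots> \<le> card (sym_diff (t <# F n) (F n)) + card (F n - A n)"
      by (rule card_Un_le)
    finally have "card {k \<in> F n. t \<otimes> k \<notin> A n} \<le> card (sym_diff (t <# F n) (F n)) + card (F n - A n)" .
    moreover have "4 * card (sym_diff (t <# F n) (F n)) < card (F n)"
      using n[OF t] pos by (simp add: field_simps)
    ultimately show ?thesis using A(2)[of n] by linarith
  qed
  \<comment> \<open>Double counting of the pairs \<open>(t, k)\<close> with \<open>t \<otimes> k\<close> outside \<open>A n\<close>.\<close>
  have "(\<Sum>k\<in>F n. 2 * card {t \<in> T. t \<otimes> k \<notin> A n}) = (\<Sum>t\<in>T. 2 * card {k \<in> F n. t \<otimes> k \<notin> A n})"
    using sum_multicount_gen[OF T(1) Fn(2)[of n], of "\<lambda>t k. t \<otimes> k \<notin> A n"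
        "\<lambda>k. card {t \<in> T. t \<otimes> k \<notin> A n}"]
    by (simp flip: sum_distrib_left)
  also have "\<dots> \<le> (\<Sum>t\<in>T. card (F n))"
    by (intro sum_mono bad)
  also have "\<dots> = (\<Sum>k\<in>F n. card T)" by simp
  finally have "\<exists>k\<in>F n. 2 * card {t \<in> T. t \<otimes> k \<notin> A n} \<le> card T"
    using sum_strict_mono[OF Fn(2,3)[of n], of "\<lambda>_. card T" "\<lambda>k. 2 * card {t \<in> T. t \<otimes> k \<notin> A n}"]
    by (meson not_le)
  then obtain k where k: "k \<in> F n" "2 * card {t \<in> T. t \<otimes> k \<notin> A n} \<le> card T" by blast
  have "card T = card {t \<in> T. t \<otimes> k \<in> A n} + card {t \<in> T. t \<otimes> k \<notin> A n}"
    using T(1) by (subst card_Un_disjoint[symmetric]) (auto intro: arg_cong[where f=card])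
  with k show ?thesis using that[of k n] by linarith
qed

section \<open>Invariant measures and orbits in \<open>L\<^sup>2\<close>\<close>

locale measure_preserving_system = topological_dynamical_system G \<phi>
  for G :: "('g, 'b) monoid_scheme" (structure) and \<phi> :: "'g \<Rightarrow> 'x::metric_space \<Rightarrow> 'x" +
  fixes \<mu> :: "'x measure"
  assumes invariant: "\<mu> \<in> invariant_measures G \<phi>"
begin

sublocale prob_space \<mu>
  using invariant by (simp add: invariant_measures_def)

sublocale grp: group G
  using group_hom by (simp add: group_hom_def)

lemma sets_eq_borel [measurable_cong]: "sets \<mu> = sets borel"
  using invariant by (simp add: invariant_measures_def)

lemma space_eq_UNIV [simp]: "space \<mu> = UNIV"
  using sets_eq_imp_space_eq[OF sets_eq_borel] by simp

lemma L2_functions_borel: "f \<in> L2_functions \<mu> \<Longrightarrow> f \<in> borel_measurable borel"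
  using L2_functions_measurable measurable_cong_sets[OF sets_eq_borel refl] by blast

lemma action_measurable [measurable]: "g \<in> carrier G \<Longrightarrow> \<phi> g \<in> measurable borel borel"
  using homeomorphism_action by (auto simp: homeomorphism_def intro: borel_measurable_continuous_onI)

lemma distr_action: "g \<in> carrier G \<Longrightarrow> distr \<mu> borel (\<phi> g) = \<mu>"
  using invariant by (simp add: invariant_measures_def)

lemma action_mult: "g \<in> carrier G \<Longrightarrow> k \<in> carrier G \<Longrightarrow> \<phi> (g \<otimes> k) x = \<phi> g (\<phi> k x)"
  by (rule composition_rule) auto

lemma integral_action:
  fixes f :: "'x \<Rightarrow> 'c::{banach, second_countable_topology}"
  assumes "g \<in> carrier G" "f \<in> borel_measurable borel"
  shows "(\<integral>x. f (\<phi> g x) \<partial>\<mu>) = (\<integral>x. f x \<partial>\<mu>)"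
  using integral_distr[of "\<phi> g" \<mu> borel f] assms by (simp add: distr_action)

lemma integrable_action:
  fixes f :: "'x \<Rightarrow> 'c::{banach, second_countable_topology}"
  assumes "g \<in> carrier G" "f \<in> borel_measurable borel"
  shows "integrable \<mu> (\<lambda>x. f (\<phi> g x)) \<longleftrightarrow> integrable \<mu> f"
  using integrable_distr_eq[of "\<phi> g" \<mu> borel f] assms by (simp add: distr_action)

lemma L2_functions_action:
  assumes "g \<in> carrier G" "f \<in> L2_functions \<mu>"
  shows "(\<lambda>x. f (\<phi> g x)) \<in> L2_functions \<mu>"
proof -
  have [measurable]: "f \<in> borel_measurable borel" by (rule L2_functions_borel[OF assms(2)])
  have "integrable \<mu> (\<lambda>x. (cmod (f (\<phi> g x)))\<^sup>2)"
    using integrable_action[OF assms(1), of "\<lambda>x. (cmod (f x))\<^sup>2"] assms(2)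
    by (simp add: L2_functions_def)
  then show ?thesis using assms(1) by (simp add: L2_functions_def)
qed

lemma L2_norm_action:
  assumes "g \<in> carrier G" "f \<in> borel_measurable borel"
  shows "L2_norm \<mu> (\<lambda>x. f (\<phi> g x)) = L2_norm \<mu> f"
  using integral_action[OF assms(1), of "\<lambda>x. (cmod (f x))\<^sup>2"] assms(2)
  by (simp add: L2_norm_def)

lemma semimetric_ball_measurable:
  assumes "F \<subseteq> carrier G" "f \<in> borel_measurable borel"
  shows "semimetric_ball (mean_semimetric \<phi> (\<lambda>x y. cmod (f x - f y)) F) x r \<in> sets \<mu>"
proof -
  have [measurable]: "f \<in> borel_measurable borel" by fact
  have [measurable]: "(\<lambda>y. \<Sum>g\<in>F. cmod (f (\<phi> g x) - f (\<phi> g y))) \<in> borel_measurable borel"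
    using assms(1) by (intro borel_measurable_sum) (auto dest: subsetD)
  have "{y \<in> space borel. (\<Sum>g\<in>F. cmod (f (\<phi> g x) - f (\<phi> g y))) / real (card F) < r} \<in> sets borel"
    by measurable
  then show ?thesis by (simp add: semimetric_ball_def mean_semimetric_def sets_eq_borel)
qed

text \<open>
  Almost periodicity in terms of functions instead of classes and topologies: in a complete metric
  space, relatively compact and totally bounded sets coincide.
\<close>

lemma orbit_totally_bounded_iff:
  assumes h: "h \<in> L2_functions \<mu>"
  shows "almost_periodic G \<phi> \<mu> h \<longleftrightarrow>
    (\<forall>\<delta>>0. \<exists>K. finite K \<and> K \<subseteq> carrier G \<and>
      (\<forall>g\<in>carrier G. \<exists>k\<in>K. L2_norm \<mu> (\<lambda>x. h (\<phi> g x) - h (\<phi> k x)) < \<delta>))"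
proof -
  interpret L2: Metric_space "L2_space \<mu>" "L2_dist \<mu>" by (rule Metric_space_L2)
  define cl where "cl g = L2_class \<mu> (h \<circ> \<phi> g)" for g
  have orb: "h \<circ> \<phi> g \<in> L2_functions \<mu>" if "g \<in> carrier G" for g
    using L2_functions_action[OF that h] by (simp add: o_def)
  have cl: "cl g \<in> L2_space \<mu>" if "g \<in> carrier G" for g
    using L2_class_in_L2_space[OF orb[OF that]] by (simp add: cl_def)
  have dist: "L2_dist \<mu> (cl k) (cl g) = L2_norm \<mu> (\<lambda>x. h (\<phi> g x) - h (\<phi> k x))"
    if "g \<in> carrier G" "k \<in> carrier G" for g k
    using L2_dist_class[OF orb[OF that(2)] orb[OF that(1)]]
      L2_norm_diff_commute[of \<mu> "\<lambda>x. h (\<phi> g x)" "\<lambda>x. h (\<phi> k x)"]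
    by (simp add: cl_def)
  have "almost_periodic G \<phi> \<mu> h \<longleftrightarrow> L2.mtotally_bounded (cl ` carrier G)"
    using h cl L2.mtotally_bounded_eq_compact_closure_of[OF L2_complete, of "cl ` carrier G"]
    unfolding almost_periodic_def cl_def by blast
  also have "\<dots> \<longleftrightarrow> (\<forall>\<delta>>0. \<exists>K. finite K \<and> K \<subseteq> carrier G \<and>
      (\<forall>g\<in>carrier G. \<exists>k\<in>K. L2_norm \<mu> (\<lambda>x. h (\<phi> g x) - h (\<phi> k x)) < \<delta>))"
  proof -
    have cover: "cl ` carrier G \<subseteq> (\<Union>y\<in>cl ` K. L2.mball y \<delta>) \<longleftrightarrow>
        (\<forall>g\<in>carrier G. \<exists>k\<in>K. L2_norm \<mu> (\<lambda>x. h (\<phi> g x) - h (\<phi> k x)) < \<delta>)"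
      if "K \<subseteq> carrier G" for K \<delta>
    proof -
      have "cl g \<in> L2.mball (cl k) \<delta> \<longleftrightarrow> L2_norm \<mu> (\<lambda>x. h (\<phi> g x) - h (\<phi> k x)) < \<delta>"
        if "g \<in> carrier G" "k \<in> K" for g k
        using that \<open>K \<subseteq> carrier G\<close> dist[of g k] cl[of g] cl[of k] by auto
      then show ?thesis by (simp add: image_subset_iff)
    qed
    have "(\<exists>L. finite L \<and> L \<subseteq> cl ` carrier G \<and> cl ` carrier G \<subseteq> (\<Union>y\<in>L. L2.mball y \<delta>)) \<longleftrightarrow>
        (\<exists>K. finite K \<and> K \<subseteq> carrier G \<and> cl ` carrier G \<subseteq> (\<Union>y\<in>cl ` K. L2.mball y \<delta>))" for \<delta>
    proof safe
      fix L assume "finite L" "L \<subseteq> cl ` carrier G" and L: "cl ` carrier G \<subseteq> (\<Union>y\<in>L. L2.mball y \<delta>)"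
      then obtain K where "K \<subseteq> carrier G" "finite K" "L = cl ` K"
        by (meson finite_subset_image)
      with L show "\<exists>K. finite K \<and> K \<subseteq> carrier G \<and> cl ` carrier G \<subseteq> (\<Union>y\<in>cl ` K. L2.mball y \<delta>)"
        by blast
    next
      fix K assume "finite K" "K \<subseteq> carrier G" "cl ` carrier G \<subseteq> (\<Union>y\<in>cl ` K. L2.mball y \<delta>)"
      then show "\<exists>L. finite L \<and> L \<subseteq> cl ` carrier G \<and> cl ` carrier G \<subseteq> (\<Union>y\<in>L. L2.mball y \<delta>)"
        by (intro exI[of _ "cl ` K"]) auto
    qed
    then show ?thesis
      unfolding L2.mtotally_bounded_def using cover by (simp cong: conj_cong)
  qed
  finally show ?thesis .
qed

section \<open>Almost periodicity implies bounded complexity\<close>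

text \<open>
  Each \<open>g\<close> is assigned a neighbour \<open>j g\<close> in a finite net \<open>K\<close> of the orbit. Where the average error
  \<open>E\<close> over \<open>g \<in> F n\<close> is small, the mean semimetric is controlled by the differences of the finitely
  many functions \<open>h \<circ> \<phi> k\<close>, \<open>k \<in> K\<close>, alone. The cells on which their rounded values agree
  therefore lie in balls around any of their good points; these cells do not depend on \<open>n\<close>, and
  neither does the bound on their number.
\<close>

lemma almost_periodic_imp_bounded_complexity:
  assumes h: "h \<in> L2_functions \<mu>" and ap: "almost_periodic G \<phi> \<mu> h"
    and F: "\<And>n. F n \<subseteq> carrier G" "\<And>n. finite (F n)" "\<And>n. F n \<noteq> {}"
  shows "bounded_complexity \<mu> (\<lambda>n. mean_semimetric \<phi> (\<lambda>x y. cmod (h x - h y)) (F n))"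
  unfolding bounded_complexity_def
proof (intro allI impI)
  fix \<epsilon> :: real assume \<epsilon>: "\<epsilon> > 0"
  have [measurable]: "h \<in> borel_measurable borel" by (rule L2_functions_borel[OF h])
  have int: "integrable \<mu> (\<lambda>x. h (\<phi> g x))" if "g \<in> carrier G" for g
    by (rule L2_functions_integrable[OF L2_functions_action[OF that h]])
  \<comment> \<open>By Markov's inequality, precision \<open>\<epsilon>\<^sup>2 / 32\<close> in the mean makes an error of \<open>\<epsilon> / 8\<close> or more occur
    with probability at most \<open>\<epsilon> / 4\<close>.\<close>
  obtain K where K: "finite K" "K \<subseteq> carrier G"
    and "\<forall>g\<in>carrier G. \<exists>k\<in>K. L2_norm \<mu> (\<lambda>x. h (\<phi> g x) - h (\<phi> k x)) < \<epsilon>\<^sup>2 / 32"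
    using ap[unfolded orbit_totally_bounded_iff[OF h], rule_format, of "\<epsilon>\<^sup>2 / 32"] \<epsilon>
    by (simp add: zero_less_power) (elim exE conjE)
  then obtain j where j: "\<And>g. g \<in> carrier G \<Longrightarrow> j g \<in> K"
      "\<And>g. g \<in> carrier G \<Longrightarrow> L2_norm \<mu> (\<lambda>x. h (\<phi> g x) - h (\<phi> (j g) x)) < \<epsilon>\<^sup>2 / 32"
    by metis
  \<comment> \<open>The functions \<open>h \<circ> \<phi> k\<close> with \<open>k \<in> K\<close> are simultaneously bounded by \<open>R\<close> on a large set.\<close>
  define s where "s x = (\<Sum>k\<in>K. cmod (h (\<phi> k x)))" for x
  have s_int: "integrable \<mu> s"
    unfolding s_def using K int by (intro Bochner_Integration.integrable_sum integrable_norm) auto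
  have [measurable]: "s \<in> borel_measurable borel"
    unfolding s_def using K by (intro borel_measurable_sum) (auto dest: subsetD)
  have s_nonneg: "0 \<le> s x" for x unfolding s_def by (intro sum_nonneg) auto
  define R where "R = 4 * expectation s / \<epsilon> + 1"
  have "expectation s \<ge> 0" using s_nonneg by (simp add: integral_nonneg_AE)
  then have "R > 0" using \<epsilon> by (simp add: R_def add_nonneg_pos)
  have "prob {x. s x \<ge> R} \<le> expectation s / R"
    using integral_Markov_inequality_measure[OF s_int sets.empty_sets, of R] \<open>R > 0\<close> s_nonneg
    by simp
  also have "\<dots> \<le> \<epsilon> / 4"
    using \<epsilon> \<open>R > 0\<close> \<open>expectation s \<ge> 0\<close> by (simp add: R_def field_simps)
  finally have s_prob: "prob {x. s x \<ge> R} \<le> \<epsilon> / 4" .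
  obtain C q where C: "finite C" and q: "\<And>z. cmod z \<le> R \<Longrightarrow> q z \<in> C"
      "\<And>z. cmod z \<le> R \<Longrightarrow> cmod (z - q z) < \<epsilon> / 8"
    using finite_net_cball[of "\<epsilon> / 8" R] \<epsilon> by auto
  define cell where "cell x = (\<lambda>k\<in>K. q (h (\<phi> k x)))" for x
  show "\<exists>M. \<forall>n. complexity \<mu> (mean_semimetric \<phi> (\<lambda>x y. cmod (h x - h y)) (F n)) \<epsilon> \<le> enat M"
  proof (intro exI allI)
    fix n
    let ?w = "mean_semimetric \<phi> (\<lambda>x y. cmod (h x - h y)) (F n)"
    have FG: "g \<in> carrier G" if "g \<in> F n" for g using F that by auto
    have pos: "real (card (F n)) > 0" using F(2,3)[of n] by (simp add: card_gt_0_iff)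
    define E where "E x = (\<Sum>g\<in>F n. cmod (h (\<phi> g x) - h (\<phi> (j g) x))) / real (card (F n))" for x
    have jG: "j g \<in> carrier G" if "g \<in> F n" for g using j(1)[OF FG[OF that]] K by auto
    have E_int: "integrable \<mu> E"
      unfolding E_def using int FG jG
      by (intro integrable_divide_zero Bochner_Integration.integrable_sum integrable_norm
          Bochner_Integration.integrable_diff) auto
    have [measurable]: "E \<in> borel_measurable borel"
      using borel_measurable_integrable[OF E_int] measurable_cong_sets[OF sets_eq_borel refl] by blast
    have E_nonneg: "0 \<le> E x" for x unfolding E_def by (intro divide_nonneg_nonneg sum_nonneg) auto
    have "expectation E = (\<Sum>g\<in>F n. expectation (\<lambda>x. cmod (h (\<phi> g x) - h (\<phi> (j g) x)))) / real (card (F n))"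
      unfolding E_def using int FG jG by (simp add: Bochner_Integration.integral_sum)
    also have "\<dots> \<le> (\<Sum>g\<in>F n. \<epsilon>\<^sup>2 / 32) / real (card (F n))"
    proof (intro divide_right_mono sum_mono)
      fix g assume g: "g \<in> F n"
      have "expectation (\<lambda>x. cmod (h (\<phi> g x) - h (\<phi> (j g) x))) \<le> L2_norm \<mu> (\<lambda>x. h (\<phi> g x) - h (\<phi> (j g) x))"
        using expectation_le_L2_norm[OF L2_functions_diff[OF L2_functions_action[OF FG[OF g] h]
            L2_functions_action[OF jG[OF g] h]]] .
      then show "expectation (\<lambda>x. cmod (h (\<phi> g x) - h (\<phi> (j g) x))) \<le> \<epsilon>\<^sup>2 / 32"
        using j(2)[OF FG[OF g]] by simp
    qed simp
    also have "\<dots> = \<epsilon>\<^sup>2 / 32" using pos by simp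
    finally have E_le: "expectation E \<le> \<epsilon>\<^sup>2 / 32" .
    have "prob {x. E x \<ge> \<epsilon> / 8} \<le> expectation E / (\<epsilon> / 8)"
      using integral_Markov_inequality_measure[OF E_int sets.empty_sets, of "\<epsilon> / 8"] \<epsilon> E_nonneg
      by simp
    also have "\<dots> \<le> (\<epsilon>\<^sup>2 / 32) / (\<epsilon> / 8)"
      using E_le \<epsilon> by (intro divide_right_mono) auto
    also have "\<dots> = \<epsilon> / 4" using \<epsilon> by (simp add: power2_eq_square)
    finally have E_prob: "prob {x. E x \<ge> \<epsilon> / 8} \<le> \<epsilon> / 4" .
    define Q where "Q = {x. s x < R \<and> E x < \<epsilon> / 8}"
    have [measurable]: "{x. s x \<ge> R} \<in> events" "{x. E x \<ge> \<epsilon> / 8} \<in> events"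
      unfolding sets_eq_borel by measurable
    have "prob (- Q) \<le> prob ({x. s x \<ge> R} \<union> {x. E x \<ge> \<epsilon> / 8})"
      by (intro finite_measure_mono) (auto simp: Q_def)
    also have "\<dots> \<le> prob {x. s x \<ge> R} + prob {x. E x \<ge> \<epsilon> / 8}"
      by (intro measure_Un_le) auto
    also have "\<dots> \<le> \<epsilon> / 2" using s_prob E_prob by simp
    finally have "prob (- Q) \<le> \<epsilon> / 2" .
    moreover have "Q \<in> events" unfolding sets_eq_borel Q_def by measurable
    ultimately have Q_prob: "1 - \<epsilon> < prob Q"
      using prob_compl[of Q] \<epsilon> by (simp add: Compl_eq_Diff_UNIV)
    have cell_mem: "cell x \<in> K \<rightarrow>\<^sub>E C" and cell_near: "k \<in> K \<Longrightarrow> cmod (h (\<phi> k x) - cell x k) < \<epsilon> / 8"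
      if "x \<in> Q" for x k
    proof -
      have le: "cmod (h (\<phi> k x)) \<le> R" if "k \<in> K" for k
      proof -
        have "cmod (h (\<phi> k x)) \<le> s x"
          unfolding s_def using K(1) that by (intro member_le_sum) auto
        then show ?thesis using \<open>x \<in> Q\<close> by (simp add: Q_def)
      qed
      then show "cell x \<in> K \<rightarrow>\<^sub>E C" using q(1) by (auto simp: cell_def)
      show "cmod (h (\<phi> k x) - cell x k) < \<epsilon> / 8" if "k \<in> K"
        using q(2)[OF le[OF that]] that by (simp add: cell_def)
    qed
    have close: "?w x y < \<epsilon> / 2" if "x \<in> Q" "y \<in> Q" "cell x = cell y" for x y
    proof -
      have "cmod (h (\<phi> g x) - h (\<phi> g y)) \<le>
          cmod (h (\<phi> g x) - h (\<phi> (j g) x)) + cmod (h (\<phi> g y) - h (\<phi> (j g) y)) + \<epsilon> / 4"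
        if g: "g \<in> F n" for g
      proof -
        have k: "j g \<in> K" using j(1)[OF FG[OF g]] .
        show ?thesis
          using cell_near[OF \<open>x \<in> Q\<close> k] cell_near[OF \<open>y \<in> Q\<close> k] \<open>cell x = cell y\<close>
            norm_triangle_ineq4[of "h (\<phi> (j g) x) - cell x (j g)" "h (\<phi> (j g) y) - cell x (j g)"]
            norm_triangle_ineq4[of "h (\<phi> g x) - h (\<phi> (j g) x)" "h (\<phi> g y) - h (\<phi> (j g) y)"]
            norm_triangle_ineq[of "h (\<phi> g x) - h (\<phi> (j g) x) - (h (\<phi> g y) - h (\<phi> (j g) y))"
              "h (\<phi> (j g) x) - h (\<phi> (j g) y)"]
          by simp
      qed
      then have "(\<Sum>g\<in>F n. cmod (h (\<phi> g x) - h (\<phi> g y))) \<le>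
          (\<Sum>g\<in>F n. cmod (h (\<phi> g x) - h (\<phi> (j g) x)) + cmod (h (\<phi> g y) - h (\<phi> (j g) y)) + \<epsilon> / 4)"
        by (rule sum_mono)
      then have "?w x y \<le> (\<Sum>g\<in>F n. cmod (h (\<phi> g x) - h (\<phi> (j g) x)) + cmod (h (\<phi> g y) - h (\<phi> (j g) y)) + \<epsilon> / 4) / real (card (F n))"
        unfolding mean_semimetric_def by (rule divide_right_mono) simp
      also have "\<dots> = E x + E y + \<epsilon> / 4"
        using pos by (simp add: E_def sum.distrib add_divide_distrib)
      also have "\<dots> < \<epsilon> / 2" using that by (simp add: Q_def)
      finally show ?thesis .
    qed
    define pt where "pt c = (SOME x. x \<in> Q \<and> cell x = c)" for c
    define S where "S = pt ` (cell ` Q)"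
    have sub: "cell ` Q \<subseteq> K \<rightarrow>\<^sub>E C" using cell_mem by auto
    have fin: "finite (K \<rightarrow>\<^sub>E C)" using K(1) C by (intro finite_PiE) auto
    have "finite S" unfolding S_def using finite_subset[OF sub fin] by simp
    moreover have "card S \<le> card (K \<rightarrow>\<^sub>E C)"
      unfolding S_def using card_image_le[OF finite_subset[OF sub fin], of pt] card_mono[OF fin sub]
      by linarith
    moreover have "Q \<subseteq> (\<Union>x\<in>S. semimetric_ball ?w x (\<epsilon> / 2))"
    proof
      fix y assume y: "y \<in> Q"
      then have "pt (cell y) \<in> Q \<and> cell (pt (cell y)) = cell y"
        unfolding pt_def by (intro someI[of "\<lambda>x. x \<in> Q \<and> cell x = cell y" y]) simp
      then have "?w (pt (cell y)) y < \<epsilon> / 2" using close y by blast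
      moreover have "pt (cell y) \<in> S" using y by (simp add: S_def)
      ultimately show "y \<in> (\<Union>x\<in>S. semimetric_ball ?w x (\<epsilon> / 2))"
        by (auto simp: semimetric_ball_def)
    qed
    then have "prob Q \<le> prob (\<Union>x\<in>S. semimetric_ball ?w x (\<epsilon> / 2))"
      using \<open>finite S\<close> F(1)
      by (intro finite_measure_mono sets.finite_UN semimetric_ball_measurable) auto
    then have "1 - \<epsilon> < prob (\<Union>x\<in>S. semimetric_ball ?w x (\<epsilon> / 2))"
      using Q_prob by simp
    ultimately show "complexity \<mu> ?w \<epsilon> \<le> enat (card (K \<rightarrow>\<^sub>E C))"
      by (intro complexity_le_of_finite_cover)
  qed
qed


section \<open>Bounded complexity implies almost periodicity\<close>

text \<open>
  Off the small complement of the union \<open>U\<close> of the balls, \<open>f \<circ> \<phi> g\<close> is compared with the step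
  function whose value at \<open>y\<close> is \<open>f (\<phi> g (x (i y)))\<close>, where \<open>x (i y)\<close> is the centre of a ball
  containing \<open>y\<close>. The error \<open>e g\<close> has mean at most \<open>\<epsilon> / 2\<close> over \<open>g \<in> A\<close> by the definition of the
  balls, so that it exceeds \<open>2 * \<epsilon>\<close> for at most a quarter of them. The step functions are
  determined up to \<open>\<epsilon>\<close> by the rounded values at the centres, which serve as the colour of \<open>g\<close>.
  In the final estimate \<open>6 * \<epsilon>\<close> collects the two errors \<open>e\<close> and the two rounding errors, and
  \<open>2 * R * \<epsilon>\<close> is the contribution of the complement of \<open>U\<close>.
\<close>

lemma bounded_complexity_colouring:
  assumes f: "f \<in> borel_measurable borel" "\<And>x. cmod (f x) \<le> R"
    and \<epsilon>: "\<epsilon> > 0"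
    and C: "finite C" "\<And>z. cmod z \<le> R \<Longrightarrow> q z \<in> C" "\<And>z. cmod z \<le> R \<Longrightarrow> cmod (z - q z) < \<epsilon>"
    and A: "A \<subseteq> carrier G" "finite A"
    and M: "complexity \<mu> (mean_semimetric \<phi> (\<lambda>x y. cmod (f x - f y)) A) \<epsilon> \<le> enat M"
  obtains A' and col :: "'g \<Rightarrow> nat \<Rightarrow> complex"
    where "A' \<subseteq> A" "4 * card (A - A') \<le> card A" "card (col ` A') \<le> card C ^ M"
      "\<And>g k. \<lbrakk>g \<in> A'; k \<in> A'; col g = col k\<rbrakk> \<Longrightarrow>
         expectation (\<lambda>x. cmod (f (\<phi> g x) - f (\<phi> k x))) \<le> (6 + 2 * R) * \<epsilon>"
proof -
  let ?w = "mean_semimetric \<phi> (\<lambda>x y. cmod (f x - f y)) A"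
  have [measurable]: "f \<in> borel_measurable borel" by (rule f(1))
  have AG: "g \<in> carrier G" if "g \<in> A" for g using A that by auto
  have "R \<ge> 0" using f(2)[of undefined] norm_ge_zero[of "f undefined"] by linarith
  have diff: "cmod (f x - f y) \<le> 2 * R" for x y
    using norm_triangle_ineq4[of "f x" "f y"] f(2)[of x] f(2)[of y] by linarith
  obtain m x where "m \<le> M" and
    U_prob: "1 - \<epsilon> < prob (\<Union>i\<in>{1..m}. semimetric_ball ?w (x i) (\<epsilon> / 2))"
    using M[unfolded complexity_le_iff] by (elim exE conjE)
  define U where "U = (\<Union>i\<in>{1..m}. semimetric_ball ?w (x i) (\<epsilon> / 2))"
  have ball [measurable]: "semimetric_ball ?w (x i) (\<epsilon> / 2) \<in> sets borel" for i
    using semimetric_ball_measurable[OF A(1) f(1)] by (simp add: sets_eq_borel)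
  have U [measurable]: "U \<in> sets borel"
    unfolding U_def by measurable
  \<comment> \<open>A measurable choice of a ball containing a given point of \<open>U\<close>.\<close>
  define i where "i y = (LEAST i. i \<in> {1..m} \<and> y \<in> semimetric_ball ?w (x i) (\<epsilon> / 2))" for y
  have i: "i y \<in> {1..m} \<and> y \<in> semimetric_ball ?w (x (i y)) (\<epsilon> / 2)" if "y \<in> U" for y
  proof -
    have "\<exists>j. j \<in> {1..m} \<and> y \<in> semimetric_ball ?w (x j) (\<epsilon> / 2)"
      using that by (simp only: U_def UN_iff Bex_def)
    from LeastI_ex[OF this] show ?thesis by (simp only: i_def)
  qed
  have i_meas [measurable]: "i \<in> measurable borel (count_space UNIV)"
    unfolding i_def by measurable
  define e where "e g y = indicator U y * cmod (f (\<phi> g y) - f (\<phi> g (x (i y))))" for g y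
  have e_meas [measurable]: "e g \<in> borel_measurable borel" if [simp]: "g \<in> carrier G" for g
  proof -
    have [measurable]: "(\<lambda>y. f (\<phi> g (x (i y)))) \<in> borel_measurable borel"
      by (rule measurable_compose[OF i_meas]) simp
    show ?thesis unfolding e_def by measurable
  qed
  have e_nonneg: "0 \<le> e g y" for g y by (simp add: e_def)
  have e_int: "integrable \<mu> (e g)" if "g \<in> carrier G" for g
  proof (rule integrable_const_bound[where B="2 * R"])
    show "AE y in \<mu>. norm (e g y) \<le> 2 * R"
      using diff \<open>R \<ge> 0\<close> by (auto simp: e_def indicator_def)
    show "e g \<in> borel_measurable \<mu>" using e_meas[OF that] by measurable
  qed
  have sum_e: "(\<Sum>g\<in>A. e g y) \<le> card A * (\<epsilon> / 2)" for y
  proof (cases "y \<in> U \<and> A \<noteq> {}")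
    case True
    then have "card A > 0" using A(2) by (simp add: card_gt_0_iff)
    have "?w (x (i y)) y < \<epsilon> / 2" using i[of y] True by (simp add: semimetric_ball_def)
    then have "(\<Sum>g\<in>A. cmod (f (\<phi> g (x (i y))) - f (\<phi> g y))) < card A * (\<epsilon> / 2)"
      using \<open>card A > 0\<close> by (simp add: mean_semimetric_def field_simps)
    then show ?thesis using True by (simp add: e_def norm_minus_commute)
  next
    case False
    then show ?thesis using \<epsilon> by (auto simp: e_def)
  qed
  define A' where "A' = {g \<in> A. expectation (e g) \<le> 2 * \<epsilon>}"
  have "2 * \<epsilon> * card (A - A') = (\<Sum>g\<in>A - A'. 2 * \<epsilon>)" by simp
  also have "\<dots> \<le> (\<Sum>g\<in>A - A'. expectation (e g))"
    by (intro sum_mono) (auto simp: A'_def)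
  also have "\<dots> \<le> (\<Sum>g\<in>A. expectation (e g))"
    using A(2) e_nonneg by (intro sum_mono2) (auto simp: integral_nonneg_AE)
  also have "\<dots> = expectation (\<lambda>y. \<Sum>g\<in>A. e g y)"
    using e_int AG by (intro Bochner_Integration.integral_sum[symmetric]) auto
  also have "\<dots> \<le> expectation (\<lambda>y. card A * (\<epsilon> / 2))"
    using e_int AG sum_e by (intro integral_mono Bochner_Integration.integrable_sum) auto
  also have "\<dots> = card A * (\<epsilon> / 2)" using prob_space by simp
  finally have "real (4 * card (A - A')) \<le> real (card A)"
    using \<epsilon> by (simp add: field_simps)
  then have A'_card: "4 * card (A - A') \<le> card A" by linarith
  define col where "col g = (\<lambda>i\<in>{1..m}. q (f (\<phi> g (x i))))" for g
  have "col ` A' \<subseteq> {1..m} \<rightarrow>\<^sub>E C"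
    using C(2) f(2) by (auto simp: col_def)
  then have "card (col ` A') \<le> card ({1..m} \<rightarrow>\<^sub>E C)"
    using C(1) by (intro card_mono finite_PiE) auto
  also have "\<dots> = card C ^ m" by (simp add: card_PiE)
  also have "\<dots> \<le> card C ^ M"
    using C(1) C(2)[of 0] \<open>R \<ge> 0\<close> \<open>m \<le> M\<close>
    by (intro power_increasing) (auto simp: Suc_le_eq card_gt_0_iff)
  finally have col_card: "card (col ` A') \<le> card C ^ M" .
  have "expectation (\<lambda>y. cmod (f (\<phi> g y) - f (\<phi> k y))) \<le> (6 + 2 * R) * \<epsilon>"
    if g: "g \<in> A'" and k: "k \<in> A'" and eq: "col g = col k" for g k
  proof -
    have gk: "g \<in> carrier G" "k \<in> carrier G" using g k AG by (auto simp: A'_def)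
    have [measurable]: "\<phi> g \<in> measurable borel borel" "\<phi> k \<in> measurable borel borel"
      using gk by measurable
    have pointwise: "cmod (f (\<phi> g y) - f (\<phi> k y)) \<le>
        e g y + e k y + 2 * \<epsilon> + 2 * R * indicator (- U) y" for y
    proof (cases "y \<in> U")
      case True
      have "q (f (\<phi> g (x (i y)))) = q (f (\<phi> k (x (i y))))"
        using fun_cong[OF eq, of "i y"] i[OF True] by (simp add: col_def)
      then show ?thesis
        using True C(3)[OF f(2), of "\<phi> g (x (i y))"] C(3)[OF f(2), of "\<phi> k (x (i y))"]
          norm_triangle_ineq4[of "f (\<phi> g (x (i y))) - q (f (\<phi> g (x (i y))))"
            "f (\<phi> k (x (i y))) - q (f (\<phi> k (x (i y))))"]
          norm_triangle_ineq4[of "f (\<phi> g y) - f (\<phi> g (x (i y)))" "f (\<phi> k y) - f (\<phi> k (x (i y)))"]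
          norm_triangle_ineq[of "f (\<phi> g y) - f (\<phi> g (x (i y))) - (f (\<phi> k y) - f (\<phi> k (x (i y))))"
            "f (\<phi> g (x (i y))) - f (\<phi> k (x (i y)))"]
        by (simp add: e_def)
    next
      case False
      then show ?thesis using diff[of "\<phi> g y" "\<phi> k y"] \<epsilon> by (simp add: e_def)
    qed
    have ind_int: "integrable \<mu> (\<lambda>y. indicator (- U) y :: real)"
      using U by (intro integrable_const_bound[where B=1]) (auto simp: indicator_def sets_eq_borel)
    have "integrable \<mu> (\<lambda>y. cmod (f (\<phi> g y) - f (\<phi> k y)))"
      using diff by (intro integrable_const_bound[where B="2 * R"]) auto
    then have "expectation (\<lambda>y. cmod (f (\<phi> g y) - f (\<phi> k y))) \<le>
        expectation (\<lambda>y. e g y + e k y + 2 * \<epsilon> + 2 * R * indicator (- U) y)"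
      using pointwise e_int gk ind_int by (intro integral_mono) auto
    also have "\<dots> = expectation (e g) + expectation (e k) + 2 * \<epsilon> + 2 * R * prob (- U)"
      using e_int gk ind_int U prob_space by (simp add: sets_eq_borel)
    also have "prob (- U) \<le> \<epsilon>"
      using prob_compl[of U] U U_prob[folded U_def] by (simp add: sets_eq_borel Compl_eq_Diff_UNIV)
    then have "expectation (e g) + expectation (e k) + 2 * \<epsilon> + 2 * R * prob (- U)
        \<le> 2 * \<epsilon> + 2 * \<epsilon> + 2 * \<epsilon> + 2 * R * \<epsilon>"
      using g k \<open>R \<ge> 0\<close> by (intro add_mono mult_left_mono) (auto simp: A'_def)
    also have "\<dots> = (6 + 2 * R) * \<epsilon>" by (simp add: algebra_simps)
    finally show ?thesis .
  qed
  then show ?thesis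
    using A'_card col_card by (intro that[of A' col]) (auto simp: A'_def)
qed


text \<open>
  Smaller differences give a smaller mean semimetric and hence larger balls. In the application \<open>f\<close> is
  obtained from \<open>h\<close> by clipping.
\<close>

lemma complexity_mono_of_lipschitz:
  assumes "\<And>x y. cmod (f x - f y) \<le> cmod (h x - h y)" and "h \<in> borel_measurable borel"
    "f \<in> borel_measurable borel" "F \<subseteq> carrier G"
  shows "complexity \<mu> (mean_semimetric \<phi> (\<lambda>x y. cmod (f x - f y)) F) \<epsilon> \<le>
    complexity \<mu> (mean_semimetric \<phi> (\<lambda>x y. cmod (h x - h y)) F) \<epsilon>"
proof -
  let ?B = "\<lambda>f x. semimetric_ball (mean_semimetric \<phi> (\<lambda>x y. cmod (f x - f y)) F) x (\<epsilon> / 2)"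
  have "mean_semimetric \<phi> (\<lambda>x y. cmod (f x - f y)) F x y \<le> mean_semimetric \<phi> (\<lambda>x y. cmod (h x - h y)) F x y"
    for x y
    unfolding mean_semimetric_def using assms(1) by (intro divide_right_mono sum_mono) auto
  then have sub: "?B h x \<subseteq> ?B f x" for x
    unfolding semimetric_ball_def by (intro Collect_mono impI) (rule order.strict_trans1)
  have "prob (\<Union>i\<in>{1..m}. ?B h (x i)) \<le> prob (\<Union>i\<in>{1..m}. ?B f (x i))" for m :: nat and x
    using sub assms(3,4)
    by (intro finite_measure_mono UN_mono sets.finite_UN semimetric_ball_measurable) auto
  then have sub2: "{m. \<exists>x :: nat \<Rightarrow> 'x. prob (\<Union>i\<in>{1..m}. ?B h (x i)) > 1 - \<epsilon>}
      \<subseteq> {m. \<exists>x :: nat \<Rightarrow> 'x. prob (\<Union>i\<in>{1..m}. ?B f (x i)) > 1 - \<epsilon>}"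
    by (intro Collect_mono impI, elim exE, intro exI) (rule less_le_trans)
  show ?thesis
    unfolding complexity_def by (intro Inf_superset_mono image_mono sub2)
qed

text \<open>
  A \<open>\<delta>\<close>-separated subset \<open>T\<close> of the orbit is moved by right translation, which preserves the
  distances, until at least half of it lies in the well-coloured part of some \<open>F n\<close>. There two of
  its elements would share a colour and be closer than \<open>\<delta>\<close> if \<open>T\<close> had more than twice as many
  elements as there are colours.
\<close>

lemma bounded_complexity_imp_almost_periodic:
  assumes h: "h \<in> L2_functions \<mu>" and F: "Folner_sequence G F"
    and bc: "bounded_complexity \<mu> (\<lambda>n. mean_semimetric \<phi> (\<lambda>x y. cmod (h x - h y)) (F n))"
  shows "almost_periodic G \<phi> \<mu> h"
  unfolding orbit_totally_bounded_iff[OF h]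
proof (intro allI impI)
  fix \<delta> :: real assume \<delta>: "\<delta> > 0"
  define D where "D g k = L2_norm \<mu> (\<lambda>x. h (\<phi> g x) - h (\<phi> k x))" for g k
  have Fn: "F n \<subseteq> carrier G" "finite (F n)" for n
    using F by (auto simp: Folner_sequence_def)
  have [measurable]: "h \<in> borel_measurable borel" by (rule L2_functions_borel[OF h])
  obtain R where R: "R > 0" "L2_norm \<mu> (\<lambda>x. h x - clip R (h x)) < \<delta> / 4"
    using L2_approx_by_clip[OF h, of "\<delta> / 4"] \<delta> by auto
  define f where "f x = clip R (h x)" for x
  have [measurable]: "clip R \<in> borel_measurable borel" using R(1) by (intro clip_measurable) simp
  have f_meas [measurable]: "f \<in> borel_measurable borel" unfolding f_def by measurable
  have f_le: "cmod (f x) \<le> R" for x using R(1) by (simp add: f_def norm_clip_le)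
  have f: "f \<in> L2_functions \<mu>"
    using f_le by (rule bounded_in_L2_functions[rotated]) measurable
  define \<epsilon> where "\<epsilon> = \<delta>\<^sup>2 / (16 * R * (6 + 2 * R))"
  have \<epsilon>: "\<epsilon> > 0" using R(1) \<delta> by (simp add: \<epsilon>_def)
  \<comment> \<open>With this \<open>\<epsilon>\<close>, closeness in the mean of the clipped functions gives closeness of the originals.\<close>
  have D_less: "D g k < \<delta>"
    if g: "g \<in> carrier G" and k: "k \<in> carrier G"
      and le: "expectation (\<lambda>x. cmod (f (\<phi> g x) - f (\<phi> k x))) \<le> (6 + 2 * R) * \<epsilon>" for g k
  proof -
    have [measurable]: "\<phi> g \<in> measurable borel borel" "\<phi> k \<in> measurable borel borel"
      using g k by measurable
    have "cmod (f (\<phi> g x) - f (\<phi> k x)) \<le> 2 * R" for x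
      using norm_triangle_ineq4[of "f (\<phi> g x)" "f (\<phi> k x)"] f_le[of "\<phi> g x"] f_le[of "\<phi> k x"] by linarith
    then have "(L2_norm \<mu> (\<lambda>x. f (\<phi> g x) - f (\<phi> k x)))\<^sup>2
        \<le> 2 * R * expectation (\<lambda>x. cmod (f (\<phi> g x) - f (\<phi> k x)))"
      by (intro L2_norm_sq_le_expectation) auto
    also have "\<dots> \<le> 2 * R * ((6 + 2 * R) * \<epsilon>)"
      using le R(1) by (intro mult_left_mono) auto
    also have "\<dots> = \<delta>\<^sup>2 / 8"
      using R(1) by (simp add: \<epsilon>_def divide_simps)
    also have "\<dots> < (\<delta> / 2)\<^sup>2" using \<delta> by (simp add: power2_eq_square)
    finally have "(L2_norm \<mu> (\<lambda>x. f (\<phi> g x) - f (\<phi> k x)))\<^sup>2 < (\<delta> / 2)\<^sup>2" .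
    then have ff: "L2_norm \<mu> (\<lambda>x. f (\<phi> g x) - f (\<phi> k x)) < \<delta> / 2"
      by (rule power2_less_imp_less) (use \<delta> in simp)
    have hf: "L2_norm \<mu> (\<lambda>x. h (\<phi> a x) - f (\<phi> a x)) < \<delta> / 4" if "a \<in> carrier G" for a
      using L2_norm_action[OF that, of "\<lambda>x. h x - f x"] R(2) by (simp add: f_def)
    have mem: "(\<lambda>x. h (\<phi> a x)) \<in> L2_functions \<mu>" "(\<lambda>x. f (\<phi> a x)) \<in> L2_functions \<mu>"
      if "a \<in> carrier G" for a
      using L2_functions_action[OF that] h f by auto
    have "D g k \<le> L2_norm \<mu> (\<lambda>x. h (\<phi> g x) - f (\<phi> g x)) + L2_norm \<mu> (\<lambda>x. f (\<phi> g x) - h (\<phi> k x))"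
      unfolding D_def by (intro L2_norm_diff_triangle mem g k)
    also have "L2_norm \<mu> (\<lambda>x. f (\<phi> g x) - h (\<phi> k x)) \<le>
        L2_norm \<mu> (\<lambda>x. f (\<phi> g x) - f (\<phi> k x)) + L2_norm \<mu> (\<lambda>x. f (\<phi> k x) - h (\<phi> k x))"
      by (intro L2_norm_diff_triangle mem g k)
    finally show ?thesis
      using ff hf[OF g] hf[OF k] L2_norm_diff_commute[of \<mu> "\<lambda>x. f (\<phi> k x)" "\<lambda>x. h (\<phi> k x)"]
      by linarith
  qed
  obtain M where M: "\<And>n. complexity \<mu> (mean_semimetric \<phi> (\<lambda>x y. cmod (h x - h y)) (F n)) \<epsilon> \<le> enat M"
    using bc \<epsilon> by (auto simp: bounded_complexity_def)
  have M': "complexity \<mu> (mean_semimetric \<phi> (\<lambda>x y. cmod (f x - f y)) (F n)) \<epsilon> \<le> enat M" for n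
    by (rule order_trans[OF complexity_mono_of_lipschitz M])
      (use R(1) Fn in \<open>auto simp: f_def intro: clip_lipschitz\<close>)
  obtain C q where C: "finite C" "\<And>z. cmod z \<le> R \<Longrightarrow> q z \<in> C" "\<And>z. cmod z \<le> R \<Longrightarrow> cmod (z - q z) < \<epsilon>"
    using finite_net_cball[OF \<epsilon>, of R] by metis
  define N where "N = card C ^ M"
  define good where "good n A' col \<longleftrightarrow>
      A' \<subseteq> F n \<and> 4 * card (F n - A') \<le> card (F n) \<and> card (col ` A') \<le> N \<and>
      (\<forall>g\<in>A'. \<forall>k\<in>A'. col g = col k \<longrightarrow>
         expectation (\<lambda>x. cmod (f (\<phi> g x) - f (\<phi> k x))) \<le> (6 + 2 * R) * \<epsilon>)"
    for n A' and col :: "'g \<Rightarrow> nat \<Rightarrow> complex"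
  have "\<exists>A' col. good n A' col" for n
  proof (rule bounded_complexity_colouring[OF f_meas f_le \<epsilon> C Fn M', of n])
    fix A' and col :: "'g \<Rightarrow> nat \<Rightarrow> complex"
    assume "A' \<subseteq> F n" "4 * card (F n - A') \<le> card (F n)" "card (col ` A') \<le> card C ^ M"
      and "\<And>g k. \<lbrakk>g \<in> A'; k \<in> A'; col g = col k\<rbrakk> \<Longrightarrow>
         expectation (\<lambda>x. cmod (f (\<phi> g x) - f (\<phi> k x))) \<le> (6 + 2 * R) * \<epsilon>"
    then have "good n A' col" by (simp add: good_def N_def)
    then show "\<exists>A' col. good n A' col" by (intro exI)
  qed
  then obtain A col where good: "\<And>n. good n (A n) (col n)"
    by metis
  have A: "A n \<subseteq> F n" "4 * card (F n - A n) \<le> card (F n)" for n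
    using good[of n] by (auto simp: good_def)
  have col_card: "card (col n ` A n) \<le> N" for n
    using good[of n] by (simp add: good_def)
  have col_eq: "expectation (\<lambda>x. cmod (f (\<phi> g x) - f (\<phi> k x))) \<le> (6 + 2 * R) * \<epsilon>"
    if "g \<in> A n" "k \<in> A n" "col n g = col n k" for n g k
    using good[of n] that by (simp add: good_def)
  define separated where
    "separated T \<longleftrightarrow> finite T \<and> T \<subseteq> carrier G \<and> (\<forall>s\<in>T. \<forall>t\<in>T. s \<noteq> t \<longrightarrow> D s t \<ge> \<delta>)" for T
  have card_le: "card T \<le> 2 * N" if T: "separated T" for T
  proof (rule ccontr)
    assume "\<not> card T \<le> 2 * N"
    moreover have TG: "finite T" "T \<subseteq> carrier G" using T by (auto simp: separated_def)
    then obtain n k where k: "k \<in> F n" and "card T \<le> 2 * card {t \<in> T. t \<otimes> k \<in> A n}"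
      using grp.Folner_half_of_translates[OF F A] by metis
    ultimately have large: "N < card {t \<in> T. t \<otimes> k \<in> A n}" by linarith
    have kG: "k \<in> carrier G" using k Fn by auto
    have "(\<lambda>t. col n (t \<otimes> k)) ` {t \<in> T. t \<otimes> k \<in> A n} \<subseteq> col n ` A n" by auto
    then have "card ((\<lambda>t. col n (t \<otimes> k)) ` {t \<in> T. t \<otimes> k \<in> A n}) \<le> N"
      using col_card[of n] card_mono[of "col n ` A n"] finite_subset[OF A(1) Fn(2), of n]
      by (meson finite_imageI order_trans)
    then have "\<not> inj_on (\<lambda>t. col n (t \<otimes> k)) {t \<in> T. t \<otimes> k \<in> A n}"
      using large by (intro pigeonhole) linarith
    then obtain s t where st: "s \<in> T" "t \<in> T" "s \<noteq> t" "s \<otimes> k \<in> A n" "t \<otimes> k \<in> A n"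
        "col n (s \<otimes> k) = col n (t \<otimes> k)"
      by (auto simp: inj_on_def)
    have stG: "s \<in> carrier G" "t \<in> carrier G" using st TG by auto
    have [measurable]: "\<phi> s \<in> measurable borel borel" "\<phi> t \<in> measurable borel borel"
      using stG by measurable
    have "expectation (\<lambda>x. cmod (f (\<phi> s x) - f (\<phi> t x))) =
        expectation (\<lambda>x. cmod (f (\<phi> s (\<phi> k x)) - f (\<phi> t (\<phi> k x))))"
      by (rule integral_action[OF kG, symmetric]) measurable
    also have "\<dots> = expectation (\<lambda>x. cmod (f (\<phi> (s \<otimes> k) x) - f (\<phi> (t \<otimes> k) x)))"
      using stG kG by (simp add: action_mult)
    also have "\<dots> \<le> (6 + 2 * R) * \<epsilon>"
      using st by (intro col_eq)
    finally have "D s t < \<delta>" using D_less stG by blast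
    moreover have "\<delta> \<le> D s t" using T st(1-3) by (simp add: separated_def)
    ultimately show False by simp
  qed
  have "separated {}" by (simp add: separated_def)
  moreover have "\<forall>T. separated T \<longrightarrow> card T < Suc (2 * N)"
    using card_le by (simp add: less_Suc_eq_le)
  ultimately have "\<exists>T. separated T \<and> (\<forall>S. separated S \<longrightarrow> card S \<le> card T)"
    by (rule ex_has_greatest_nat)
  then obtain T where T: "separated T" and max: "\<And>S. separated S \<Longrightarrow> card S \<le> card T"
    by (elim exE conjE) (rule that, assumption, simp)
  have "\<exists>k\<in>T. D g k < \<delta>" if g: "g \<in> carrier G" for g
  proof (rule ccontr)
    assume *: "\<not> (\<exists>k\<in>T. D g k < \<delta>)"
    have "D g g = 0" by (simp add: D_def L2_norm_def)
    then have "g \<notin> T" using * \<delta> by auto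
    have far: "\<delta> \<le> D g k" if "k \<in> T" for k using * that by (meson not_le)
    have sym: "D k g = D g k" for k unfolding D_def by (rule L2_norm_diff_commute)
    have "\<delta> \<le> D s t" if "s \<in> insert g T" "t \<in> insert g T" "s \<noteq> t" for s t
    proof (cases "s = g")
      case True
      then show ?thesis using that far by simp
    next
      case False
      then show ?thesis using that far[of s] sym[of s] T by (cases "t = g") (simp_all add: separated_def)
    qed
    then have "separated (insert g T)"
      using T g by (simp add: separated_def)
    then have "card (insert g T) \<le> card T" by (rule max)
    then show False using T \<open>g \<notin> T\<close> by (simp add: separated_def)
  qed
  then show "\<exists>K. finite K \<and> K \<subseteq> carrier G \<and>
      (\<forall>g\<in>carrier G. \<exists>k\<in>K. L2_norm \<mu> (\<lambda>x. h (\<phi> g x) - h (\<phi> k x)) < \<delta>)"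
    using T unfolding D_def separated_def by (intro exI[of _ T]) auto
qed

end

section \<open>The equivalence\<close>

theorem theorem2p1:
  fixes G :: "('g, 'b) monoid_scheme"
    and \<phi> :: "'g \<Rightarrow> 'x::metric_space \<Rightarrow> 'x"
    and \<mu> :: "'x measure"
    and F :: "nat \<Rightarrow> 'g set"
    and h :: "'x \<Rightarrow> complex"
    and H :: "'x \<Rightarrow> 'x \<Rightarrow> real"
  assumes "topological_dynamical_system G \<phi>"
    and "\<mu> \<in> invariant_measures G \<phi>"
    and "Folner_sequence G F"
    and "h \<in> L2_functions \<mu>"
    and "\<And>x y. H x y = cmod (h x - h y)"
  shows "almost_periodic G \<phi> \<mu> h \<longleftrightarrow>
         bounded_complexity \<mu> (\<lambda>n. mean_semimetric \<phi> H (F n))"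
proof -
  interpret measure_preserving_system G \<phi> \<mu>
    using assms(1,2) by (simp add: measure_preserving_system_def measure_preserving_system_axioms_def)
  have "H = (\<lambda>x y. cmod (h x - h y))"
    using assms(5) by (intro ext)
  moreover have "F n \<subseteq> carrier G \<and> finite (F n) \<and> F n \<noteq> {}" for n
    using assms(3) by (simp add: Folner_sequence_def)
  ultimately show ?thesis
    using almost_periodic_imp_bounded_complexity[OF assms(4), of F]
      bounded_complexity_imp_almost_periodic[OF assms(4,3)] by blast
qed

end
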